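(* There exists an absolute constant $C>0$ such that the following holds. Let $w$ be an $A_2$ weight on $\mathbb{R}$, let $\sigma = w^{-1}$, and let $(c_{IJ})$ be any family of real numbers, indexed by pairs of dyadic intervals $J\subset I$ with $|J|=\tfrac12|I|$, satisfying $|c_{IJ}|\le 1$. Then for all $f_1\in L^2(w)$ and $f_2\in L^2(\sigma)$, $$ \sum_{J\subset I,\ |J|=2^{-1}|I|} 2^{-1/2}\, c_{IJ}\,|(f_1,h_I)|\,|(f_2,h_J)| \;\le\; C\,[w]_{A_2}\,\|f_1\|_{w}\,\|f_2\|_{\sigma}, $$ where the sum is over all pairs of dyadic intervals $I,J$ with $J\subset I$ and $|J|=\tfrac12|I|$.
   Context: Dyadic intervals are the intervals $[k2^{m},(k+1)2^{m})$ with $k,m\in\mathbb{Z}$. For a dyadic interval $I$ with left and right halves $I_-$ and $I_+$, the Haar function is $h_I=|I|^{-1/2}(\chi_{I_+}-\chi_{I_-})$, and $(f,h_I)=\int f h_I\,dx$ (unweighted Lebesgue pairing). For a nonnegative locally integrable function $w$, positive almost everywhere, $\langle w\rangle_I=\frac1{|I|}\int_I w\,dx$. The function $w$ is an $A_2$ weight if $w$ and $\sigma=w^{-1}$ are locally integrable and $[w]_{A_2}=\sup_I\langle w\rangle_I\langle\sigma\rangle_I<\infty$, the supremum being over dyadic intervals $I$. The norms are $\|f\|_w=\left(\int |f|^2w\,dx\right)^{1/2}$ and $\|f\|_\sigma=\left(\int|f|^2\sigma\,dx\right)^{1/2}$; all functions are real-valued. The inequality is understood to include the absolute convergence of the series on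 its left-hand side. *)

theory Defs
  imports "HOL-Analysis.Analysis"
begin

definition dyadic_intervals :: "real set set" where
  "dyadic_intervals =
     {{of_int k * 2 powi m ..< (of_int k + 1) * 2 powi m} | (k::int) (m::int). True}"

text \<open>The two halves are read off from the endpoints of the interval; they are only meaningful
  for bounded half-open intervals, see the two lemmas below.\<close>

definition left_half :: "real set \<Rightarrow> real set" where
  "left_half I = {Inf I ..< (Inf I + Sup I) / 2}"

definition right_half :: "real set \<Rightarrow> real set" where
  "right_half I = {(Inf I + Sup I) / 2 ..< Sup I}"

lemma left_half_interval: "a < b \<Longrightarrow> left_half {a..<b} = {a..<(a + b) / 2}"
  by (simp add: left_half_def)

lemma right_half_interval: "a < b \<Longrightarrow> right_half {a..<b} = {(a + b) / 2..<b}"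
  by (simp add: right_half_def)

definition haar :: "real set \<Rightarrow> real \<Rightarrow> real" where
  "haar I x = measure lebesgue I powr (-1/2) *
     (indicator (right_half I) x - indicator (left_half I) x)"

definition haar_coeff :: "(real \<Rightarrow> real) \<Rightarrow> real set \<Rightarrow> real" where
  "haar_coeff f I = (\<integral>x. f x * haar I x \<partial>lebesgue)"

definition locally_integrable :: "(real \<Rightarrow> real) \<Rightarrow> bool" where
  "locally_integrable f \<longleftrightarrow> (\<forall>K. compact K \<longrightarrow> set_integrable lebesgue K f)"

definition avg :: "(real \<Rightarrow> real) \<Rightarrow> real set \<Rightarrow> real" where
  "avg w I = (LINT x:I|lebesgue. w x) / measure lebesgue I"

text \<open>The dual weight \<open>w\<^sup>-\<^sup>1\<close>. The convention \<open>inverse 0 = 0\<close> only matters on a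
  null set, as weights are positive almost everywhere.\<close>

definition dual_weight :: "(real \<Rightarrow> real) \<Rightarrow> real \<Rightarrow> real" where
  "dual_weight w x = inverse (w x)"

text \<open>Finiteness of the supremum defining the characteristic is the \<open>bdd_above\<close> clause of
  \<open>A2_weight\<close>; the real-valued \<open>A2_char w\<close> is meaningful only under that condition.\<close>

definition A2_char :: "(real \<Rightarrow> real) \<Rightarrow> real" where
  "A2_char w = (SUP I\<in>dyadic_intervals. avg w I * avg (dual_weight w) I)"

definition A2_weight :: "(real \<Rightarrow> real) \<Rightarrow> bool" where
  "A2_weight w \<longleftrightarrow>
     (\<forall>x. 0 \<le> w x) \<and> (AE x in lebesgue. 0 < w x) \<and>
     locally_integrable w \<and> locally_integrable (dual_weight w) \<and>
     bdd_above ((\<lambda>I. avg w I * avg (dual_weight w) I) ` dyadic_intervals)"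

definition in_L2 :: "(real \<Rightarrow> real) \<Rightarrow> (real \<Rightarrow> real) \<Rightarrow> bool" where
  "in_L2 w f \<longleftrightarrow> f \<in> borel_measurable lebesgue \<and> integrable lebesgue (\<lambda>x. \<bar>f x\<bar>\<^sup>2 * w x)"

definition L2_norm :: "(real \<Rightarrow> real) \<Rightarrow> (real \<Rightarrow> real) \<Rightarrow> real" where
  "L2_norm w f = sqrt (\<integral>x. \<bar>f x\<bar>\<^sup>2 * w x \<partial>lebesgue)"

definition child_pairs :: "(real set \<times> real set) set" where
  "child_pairs = {(I, J). I \<in> dyadic_intervals \<and> J \<in> dyadic_intervals \<and> J \<subseteq> I \<and>
     measure lebesgue J = measure lebesgue I / 2}"

end

(* After truncation to finitely many generations, the sum lives on a binary tree on which the averages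
   of f1, f2, |f1|, |f2|, |f1|^2 w, |f2|^2 sigma, w and sigma are martingales.  It is bounded by
   induction on the depth, with a Bellman-type potential depending on the node and on a state
   (a, b, X, Y).  Here a and b are the averages of |f1| and |f2| at the last stopping interval, an
   interval being stopped when one of these averages exceeds 4a resp. 4b, while X and Y are running
   maxima of <|f1|>/<sigma> and <|f2|>/<w>.  Inside a corona, quadratic variation controls the sum
   by ab; the selection rule a b <= [w] X Y and a Doob-type quadratic potential for the maximal
   functions with respect to sigma and w then give the linear dependence on [w]. *)
theory Submission
  imports Defs
begin

section \<open>Weighted martingales on a binary tree\<close>

definition jump :: "('a \<Rightarrow> 'a) \<Rightarrow> ('a \<Rightarrow> 'a) \<Rightarrow> ('a \<Rightarrow> real) \<Rightarrow> 'a \<Rightarrow> real" where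
  "jump l r F x = (F (r x) - F (l x)) / 2"

text \<open>The argument \<open>e\<close> carries the jump of \<open>F\<close> at the parent of \<open>x\<close>, which is paired
  with the jump of \<open>G\<close> at \<open>x\<close>.\<close>

primrec shift_sum ::
  "('a \<Rightarrow> 'a) \<Rightarrow> ('a \<Rightarrow> 'a) \<Rightarrow> ('a \<Rightarrow> real) \<Rightarrow> ('a \<Rightarrow> real) \<Rightarrow> nat \<Rightarrow> real \<Rightarrow> 'a \<Rightarrow> real"
where
  "shift_sum l r F G 0 e x = 0"
| "shift_sum l r F G (Suc n) e x = e * \<bar>jump l r G x\<bar> +
     (shift_sum l r F G n (\<bar>jump l r F x\<bar>) (l x) + shift_sum l r F G n (\<bar>jump l r F x\<bar>) (r x)) / 2"

lemma shift_sum_nonneg: "0 \<le> e \<Longrightarrow> 0 \<le> shift_sum l r F G n e x"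
  by (induction n arbitrary: e x) auto

lemma shift_sum_scale:
  assumes "t > 0"
  shows "shift_sum l r (\<lambda>x. t * F x) (\<lambda>x. G x / t) n (t * e) x = shift_sum l r F G n e x"
proof (induction n arbitrary: e x)
  case (Suc n)
  have 1: "jump l r (\<lambda>x. t * F x) x = t * jump l r F x" for x
    by (simp add: jump_def algebra_simps)
  have 2: "jump l r (\<lambda>x. G x / t) x = jump l r G x / t" for x
    by (simp add: jump_def diff_divide_distrib)
  show ?case
    using assms by (simp add: 1 2 abs_mult abs_divide Suc)
qed simp

section \<open>Elementary quadratic inequalities\<close>

text \<open>The difference of the two sides is a quadratic in \<open>X\<close> with discriminant
  \<open>4 * (u\<^sup>2 - a * t)\<close>, which is nonpositive.\<close>

lemma square_half_le:
  fixes X u a t :: real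
  assumes "u\<^sup>2 \<le> a * t" "0 < t"
  shows "X\<^sup>2 * t / 2 \<le> X\<^sup>2 * t - 2 * X * u + 2 * a"
proof -
  have "0 \<le> (X * t - 2 * u)\<^sup>2 / 2" by simp
  also have "\<dots> \<le> t * (X\<^sup>2 * t / 2 - 2 * X * u + 2 * a)"
    using assms(1)
    by (simp add: power2_eq_square algebra_simps add_divide_distrib diff_divide_distrib)
  finally have "0 \<le> X\<^sup>2 * t / 2 - 2 * X * u + 2 * a"
    using assms(2) by (simp add: zero_le_mult_iff)
  then show ?thesis by linarith
qed

text \<open>As a function of \<open>X\<close>, the quadratic is minimal at \<open>u / t\<close>, and
  the maximum is either the old value or this minimiser.\<close>

lemma square_update_max:
  fixes X u t :: real
  assumes "0 < t"
  shows "(max X (u / t))\<^sup>2 * t - 2 * max X (u / t) * u \<le> X\<^sup>2 * t - 2 * X * u"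
proof (cases "u / t \<le> X")
  case False
  have "0 \<le> (X * t - u)\<^sup>2 / t" using assms by simp
  also have "\<dots> = (X\<^sup>2 * t - 2 * X * u) - ((u / t)\<^sup>2 * t - 2 * (u / t) * u)"
    using assms by (simp add: power2_eq_square field_simps)
  finally show ?thesis using False by (simp add: max_def)
qed (simp add: max_def)

lemma mult_le_weighted_squares:
  fixes a b p q :: real
  assumes "0 < a" "0 < b"
  shows "p * q \<le> (b / a) * p\<^sup>2 + (a / b) * q\<^sup>2"
proof -
  have "0 \<le> (b * p - a * q)\<^sup>2 + (b * p)\<^sup>2 + (a * q)\<^sup>2" by simp
  also have "\<dots> = 2 * (a * b) * ((b / a) * p\<^sup>2 + (a / b) * q\<^sup>2 - p * q)"
    using assms by (simp add: power2_eq_square field_simps)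
  finally have "0 \<le> (b / a) * p\<^sup>2 + (a / b) * q\<^sup>2 - p * q"
    using assms by (subst (asm) zero_le_mult_iff) (auto simp: mult_le_0_iff)
  then show ?thesis by simp
qed

text \<open>In the application \<open>F\<close>, \<open>G\<close> average f1, f2; \<open>U\<close>,
  \<open>V\<close> their absolute values; \<open>A\<close>, \<open>B\<close> the functions |f1|^2 w,
  |f2|^2 sigma; \<open>s\<close> averages sigma and \<open>Q\<close> is the A2 characteristic.
  \<open>U_le\<close>, \<open>V_le\<close> and \<open>ws_ge\<close> are then Cauchy-Schwarz. Asking
  \<open>U\<close>, \<open>V\<close> only to dominate |F|, |G| lets \<open>perturb\<close> enlarge
  them independently of \<open>F\<close>, \<open>G\<close>.\<close>

locale weighted_tree =
  fixes l r :: "'a \<Rightarrow> 'a" and F G U V A B w s :: "'a \<Rightarrow> real" and Q :: real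
  assumes F_mean: "F x = (F (l x) + F (r x)) / 2"
    and G_mean: "G x = (G (l x) + G (r x)) / 2"
    and U_mean: "U x = (U (l x) + U (r x)) / 2"
    and V_mean: "V x = (V (l x) + V (r x)) / 2"
    and A_mean: "A x = (A (l x) + A (r x)) / 2"
    and B_mean: "B x = (B (l x) + B (r x)) / 2"
    and w_mean: "w x = (w (l x) + w (r x)) / 2"
    and s_mean: "s x = (s (l x) + s (r x)) / 2"
    and F_le: "\<bar>F x\<bar> \<le> U x" and G_le: "\<bar>G x\<bar> \<le> V x"
    and U_le: "(U x)\<^sup>2 \<le> A x * s x" and V_le: "(V x)\<^sup>2 \<le> B x * w x"
    and w_pos: "0 < w x" and s_pos: "0 < s x"
    and ws_ge: "1 \<le> w x * s x" and ws_le: "w x * s x \<le> Q"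
begin

section \<open>Jumps, children and restarts\<close>

lemma Q_ge_1: "1 \<le> Q"
  using ws_ge ws_le by (rule order_trans)

lemma jump_le: "\<bar>jump l r F x\<bar> \<le> U x" "\<bar>jump l r G x\<bar> \<le> V x"
proof -
  show "\<bar>jump l r F x\<bar> \<le> U x"
    using F_le[of "l x"] F_le[of "r x"] U_mean[of x] by (simp add: jump_def abs_le_iff)
  show "\<bar>jump l r G x\<bar> \<le> V x"
    using G_le[of "l x"] G_le[of "r x"] V_mean[of x] by (simp add: jump_def abs_le_iff)
qed

text \<open>By nonnegativity a child is at most the sum of both children. Hence a child that passes
  the threshold \<open>4 * a\<close> or \<open>4 * b\<close> overshoots to at most
  \<open>8 * a\<close> or \<open>8 * b\<close>.\<close>

lemma child_le:
  assumes "y = l x \<or> y = r x"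
  shows "U y \<le> 2 * U x" "V y \<le> 2 * V x"
  using assms F_le[of "l x"] F_le[of "r x"] U_mean[of x] G_le[of "l x"] G_le[of "r x"] V_mean[of x]
  by auto

lemma mean_square:
  "((F (l x))\<^sup>2 + (F (r x))\<^sup>2) / 2 = (F x)\<^sup>2 + (jump l r F x)\<^sup>2"
  "((G (l x))\<^sup>2 + (G (r x))\<^sup>2) / 2 = (G x)\<^sup>2 + (jump l r G x)\<^sup>2"
  unfolding F_mean[of x] G_mean[of x] jump_def by (simp_all add: power2_eq_square field_simps)

text \<open>This is the price of dropping the jump carried from the parent when a new corona
  starts.\<close>

lemma shift_sum_le_restart:
  assumes "0 \<le> e"
  shows "shift_sum l r F G n e x \<le> e * V x + shift_sum l r F G n 0 x"
proof -
  have "0 \<le> V x" using G_le[of x] by linarith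
  with assms show ?thesis
    by (cases n) (auto intro: mult_left_mono jump_le)
qed

section \<open>The potential for the maximal functions\<close>

text \<open>For fixed \<open>X\<close> and \<open>Y\<close> this is a martingale, and it decreases when \<open>X\<close> and \<open>Y\<close> are updated to
  the running maxima; this is a form of Doob's maximal inequality in \<open>L\<^sup>2\<close>.\<close>

definition doob :: "real \<Rightarrow> real \<Rightarrow> 'a \<Rightarrow> real" where
  "doob X Y x = Q * ((X\<^sup>2 * s x - 2 * X * U x + 2 * A x) + (Y\<^sup>2 * w x - 2 * Y * V x + 2 * B x))"

text \<open>By \<open>square_half_le\<close> at least half of
  \<open>X\<^sup>2 * s x + Y\<^sup>2 * w x\<close> survives. That half exceeds \<open>X * Y\<close>
  by the arithmetic-geometric mean inequality, as \<open>w x * s x\<close> is at least 1.\<close>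

lemma doob_ge:
  assumes "0 \<le> X" "0 \<le> Y"
  shows "Q * (X * Y) \<le> doob X Y x"
proof -
  have "0 \<le> (X * s x - Y)\<^sup>2" by simp
  also have "(X * s x - Y)\<^sup>2 \<le> (X * s x)\<^sup>2 - 2 * X * s x * Y + Y\<^sup>2 * (w x * s x)"
    using mult_left_mono[OF ws_ge[of x], of "Y\<^sup>2"] by (simp add: power2_eq_square algebra_simps)
  also have "\<dots> = s x * (X\<^sup>2 * s x + Y\<^sup>2 * w x - 2 * X * Y)"
    by (simp add: power2_eq_square algebra_simps)
  finally have "2 * X * Y \<le> X\<^sup>2 * s x + Y\<^sup>2 * w x"
    using s_pos[of x] by (simp add: zero_le_mult_iff)
  with square_half_le[OF U_le s_pos, of X x] square_half_le[OF V_le w_pos, of Y x]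
  have "X * Y \<le> (X\<^sup>2 * s x - 2 * X * U x + 2 * A x) + (Y\<^sup>2 * w x - 2 * Y * V x + 2 * B x)"
    by linarith
  then show ?thesis
    unfolding doob_def using Q_ge_1 by (intro mult_left_mono) auto
qed

lemma doob_mean: "(doob X Y (l x) + doob X Y (r x)) / 2 = doob X Y x"
  unfolding doob_def U_mean[of x] V_mean[of x] A_mean[of x] B_mean[of x] w_mean[of x] s_mean[of x]
  by (simp add: field_simps)

lemma doob_update: "doob (max X (U x / s x)) (max Y (V x / w x)) x \<le> doob X Y x"
  unfolding doob_def using square_update_max[OF s_pos, of X "U x" x] square_update_max[OF w_pos, of Y "V x" x] Q_ge_1
  by (intro mult_left_mono) auto

section \<open>The potential inside a corona\<close>

text \<open>The squares provide the quadratic variation; the linear terms pay for the jump at a stopped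
  child, where \<open>b * U x + a * V x\<close> is at least \<open>4 * (a * b)\<close>.\<close>

definition corona :: "real \<Rightarrow> real \<Rightarrow> 'a \<Rightarrow> real" where
  "corona a b x = - (b / a) * (F x)\<^sup>2 - (a / b) * (G x)\<^sup>2 + 80 * (b * U x + a * V x) - 160 * (a * b)"

text \<open>Only the square terms fail to be martingales. By \<open>mean_square\<close> passing to
  the children loses exactly the squared jumps, and this loss pays for products of jumps.\<close>

lemma corona_mean:
  "(corona a b (l x) + corona a b (r x)) / 2 =
     corona a b x - (b / a) * (jump l r F x)\<^sup>2 - (a / b) * (jump l r G x)\<^sup>2"
proof -
  have "(corona a b (l x) + corona a b (r x)) / 2 =
      - (b / a) * (((F (l x))\<^sup>2 + (F (r x))\<^sup>2) / 2) - (a / b) * (((G (l x))\<^sup>2 + (G (r x))\<^sup>2) / 2)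
      + 80 * (b * U x + a * V x) - 160 * (a * b)"
    unfolding corona_def U_mean[of x] V_mean[of x]
    by (simp only: add_divide_distrib diff_divide_distrib ring_distribs)
  then show ?thesis
    unfolding mean_square by (simp add: corona_def algebra_simps)
qed

text \<open>Applied with \<open>k = 4\<close> inside a corona and \<open>k = 8\<close> at a stopped
  child.\<close>

lemma square_terms_le:
  assumes "0 < a" "0 < b" "U x \<le> k * a" "V x \<le> k * b"
  shows "(b / a) * (F x)\<^sup>2 + (a / b) * (G x)\<^sup>2 \<le> 2 * k\<^sup>2 * (a * b)"
proof -
  have "(F x)\<^sup>2 \<le> (k * a)\<^sup>2" "(G x)\<^sup>2 \<le> (k * b)\<^sup>2"
    using F_le[of x] G_le[of x] assms(3,4) by (auto intro!: abs_le_square_iff[THEN iffD1])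
  then have "(b / a) * (F x)\<^sup>2 + (a / b) * (G x)\<^sup>2 \<le> (b / a) * (k * a)\<^sup>2 + (a / b) * (k * b)\<^sup>2"
    using assms(1,2) by (intro add_mono mult_left_mono) auto
  also have "\<dots> = 2 * k\<^sup>2 * (a * b)"
    using assms(1,2) by (simp add: power2_eq_square field_simps)
  finally show ?thesis .
qed

text \<open>The hypotheses are the invariant of the induction: no stop since \<open>(a, b)\<close>
  was chosen, the selection rule, and \<open>X\<close>, \<open>Y\<close> above the current ratios.
  The term \<open>(b / a) * e\<^sup>2\<close> pays for the carried jump. Positivity of
  \<open>U\<close>, \<open>V\<close> makes every restarted state positive.\<close>

lemma shift_sum_le_potential:
  assumes "\<And>x. 0 < U x" "\<And>x. 0 < V x"
    and "0 < a" "0 < b" "0 \<le> X" "0 \<le> Y" "0 \<le> e"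
    and "U x \<le> 4 * a" "V x \<le> 4 * b" "a * b \<le> Q * (X * Y)"
    and "U x \<le> X * s x" "V x \<le> Y * w x"
  shows "shift_sum l r F G n e x \<le> (b / a) * e\<^sup>2 + corona a b x + 192 * doob X Y x"
  using assms(3-)
proof (induction n arbitrary: a b X Y e x)
  \<comment> \<open>The potential must be nonnegative here. \<open>corona\<close> is at least -(32 +
    160) times \<open>a * b\<close>, which the 192 copies of \<open>doob\<close> compensate through
    the selection rule.\<close>
  case 0
  have "0 \<le> b * U x + a * V x"
    using 0 assms(1,2)[of x] by simp
  moreover have "(b / a) * (F x)\<^sup>2 + (a / b) * (G x)\<^sup>2 \<le> 32 * (a * b)"
    using square_terms_le[of a b x 4] 0 by simp
  moreover have "a * b \<le> doob X Y x"
    using 0 doob_ge[of X Y x] by linarith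
  moreover have "0 \<le> (b / a) * e\<^sup>2" using 0 by simp
  ultimately show ?case
    by (simp add: corona_def)
next
  case (Suc n)
  define p where "p = \<bar>jump l r F x\<bar>"
  have p: "0 \<le> p" "p \<le> 4 * a" "p\<^sup>2 = (jump l r F x)\<^sup>2"
    using jump_le(1)[of x] Suc.prems by (auto simp: p_def)
  have child: "shift_sum l r F G n p y \<le> (b / a) * p\<^sup>2 + corona a b y + 192 * doob X Y y"
    if y: "y = l x \<or> y = r x" for y
  proof -
    define X' Y' where "X' = max X (U y / s y)" and "Y' = max Y (V y / w y)"
    have X': "X \<le> X'" "0 \<le> X'" "U y \<le> X' * s y"
      using Suc.prems s_pos[of y] by (auto simp: X'_def pos_divide_le_eq[symmetric])
    have Y': "Y \<le> Y'" "0 \<le> Y'" "V y \<le> Y' * w y"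
      using Suc.prems w_pos[of y] by (auto simp: Y'_def pos_divide_le_eq[symmetric])
    have upd: "doob X' Y' y \<le> doob X Y y"
      unfolding X'_def Y'_def by (rule doob_update)
    show ?thesis
    proof (cases "U y \<le> 4 * a \<and> V y \<le> 4 * b")
      case True
      have "X * Y \<le> X' * Y'"
        using X' Y' Suc.prems by (intro mult_mono) auto
      then have "Q * (X * Y) \<le> Q * (X' * Y')"
        using Q_ge_1 by (intro mult_left_mono) auto
      then have "a * b \<le> Q * (X' * Y')" using Suc.prems by linarith
      then have "shift_sum l r F G n p y \<le> (b / a) * p\<^sup>2 + corona a b y + 192 * doob X' Y' y"
        using Suc.prems X' Y' p True by (intro Suc.IH) auto
      then show ?thesis using upd by linarith
    next
      \<comment> \<open>a stopped child: the induction restarts from the state \<open>(U y, V y)\<close> with \<open>e = 0\<close>\<close>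
      case False
      have Uy: "U y \<le> 8 * a" "V y \<le> 8 * b" using child_le[OF y] Suc.prems by auto
      \<comment> \<open>The selection rule for the new state: \<open>ws_le\<close> turns the product
        of the two maxima into a bound with a single factor \<open>Q\<close>.\<close>
      have "U y * V y \<le> (X' * s y) * (Y' * w y)"
        using X' Y' assms(1,2)[of y] s_pos[of y] by (intro mult_mono) auto
      also have "\<dots> = (w y * s y) * (X' * Y')" by simp
      also have "\<dots> \<le> Q * (X' * Y')"
        using ws_le[of y] X' Y' by (intro mult_right_mono) auto
      finally have "shift_sum l r F G n 0 y
          \<le> (V y / U y) * 0\<^sup>2 + corona (U y) (V y) y + 192 * doob X' Y' y"
        using X' Y' assms(1,2)[of y] by (intro Suc.IH) auto
      \<comment> \<open>At a fresh state the linear terms are 80 * 2 times the product, which the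
        constant 160 cancels.\<close>
      moreover have "corona (U y) (V y) y \<le> 0"
      proof -
        have "0 \<le> (V y / U y) * (F y)\<^sup>2" "0 \<le> (U y / V y) * (G y)\<^sup>2"
          using assms(1,2)[of y] by simp_all
        then show ?thesis by (simp add: corona_def)
      qed
      ultimately have "shift_sum l r F G n 0 y \<le> 192 * doob X Y y"
        using upd by simp
      moreover have "shift_sum l r F G n p y \<le> p * V y + shift_sum l r F G n 0 y"
        using p by (intro shift_sum_le_restart)
      moreover have "p * V y \<le> (4 * a) * (8 * b)"
        using p Uy assms(2)[of y] Suc.prems by (intro mult_mono) auto
      moreover have "(b / a) * (F y)\<^sup>2 + (a / b) * (G y)\<^sup>2 \<le> 128 * (a * b)"
        using square_terms_le[of a b y 8] Uy Suc.prems by simp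
      moreover have "4 * (a * b) \<le> b * U y + a * V y"
      proof (cases "U y \<le> 4 * a")
        case True
        then have "a * (4 * b) \<le> a * V y" using False Suc.prems by (intro mult_left_mono) auto
        then show ?thesis using Suc.prems assms(1)[of y] by (simp add: add_increasing)
      next
        case False
        then have "b * (4 * a) \<le> b * U y" using Suc.prems by (intro mult_left_mono) auto
        then show ?thesis using Suc.prems assms(2)[of y] by (simp add: add_increasing2 mult.commute)
      qed
      moreover have "0 \<le> (b / a) * p\<^sup>2" using Suc.prems by simp
      \<comment> \<open>The budget in units of \<open>a * b\<close>: 80 * 4 = 160 + 128 + 32, for
        the constant of \<open>corona\<close>, its square terms and the dropped jump.\<close>
      ultimately show ?thesis by (simp add: corona_def)
    qed
  qed
  have "shift_sum l r F G (Suc n) e x = e * \<bar>jump l r G x\<bar>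
      + (shift_sum l r F G n p (l x) + shift_sum l r F G n p (r x)) / 2"
    by (simp add: p_def)
  \<comment> \<open>The product \<open>e * \<bar>jump l r G x\<bar>\<close> is split into weighted
    squares. The square of the jump of \<open>G\<close> and the term with \<open>p\<^sup>2\<close>
    then cancel the loss in \<open>corona_mean\<close>.\<close>
  also have "\<dots> \<le> ((b / a) * e\<^sup>2 + (a / b) * (jump l r G x)\<^sup>2)
      + ((b / a) * p\<^sup>2 + (corona a b (l x) + corona a b (r x)) / 2
         + 192 * ((doob X Y (l x) + doob X Y (r x)) / 2))"
    using child[of "l x"] child[of "r x"] mult_le_weighted_squares[of a b e "\<bar>jump l r G x\<bar>"] Suc.prems
    by (auto simp: add_divide_distrib)
  also have "\<dots> = (b / a) * e\<^sup>2 + corona a b x + 192 * doob X Y x"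
    unfolding corona_mean doob_mean p(3) by simp
  finally show ?case .
qed

section \<open>Removing positivity and balancing scales\<close>

text \<open>The root starts from its own averages and ratios with \<open>e = 0\<close>. There
  \<open>corona\<close> is nonpositive and \<open>doob\<close> is at most
  \<open>2 * Q * (A x + B x)\<close>, whence 384 = 2 * 192.\<close>

lemma shift_sum_le_positive:
  assumes "\<And>x. 0 < U x" "\<And>x. 0 < V x"
  shows "shift_sum l r F G n 0 x \<le> 384 * Q * (A x + B x)"
proof -
  have "U x * V x \<le> Q * (U x / s x * (V x / w x))"
    using ws_le[of x] s_pos[of x] w_pos[of x] assms[of x]
    by (simp add: field_simps)
  then have "shift_sum l r F G n 0 x
      \<le> (V x / U x) * 0\<^sup>2 + corona (U x) (V x) x + 192 * doob (U x / s x) (V x / w x) x"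
    using assms assms[of x, THEN less_imp_le] s_pos[of x] w_pos[of x]
    by (intro shift_sum_le_potential) auto
  moreover have "0 \<le> (V x / U x) * (F x)\<^sup>2" "0 \<le> (U x / V x) * (G x)\<^sup>2"
    using assms[of x] by simp_all
  moreover have "doob (U x / s x) (V x / w x) x \<le> Q * (2 * A x + 2 * B x)"
  proof -
    have "(u / t)\<^sup>2 * t - 2 * (u / t) * u \<le> 0" if "0 < t" for u t :: real
      using that by (simp add: power2_eq_square field_simps)
    from this[OF s_pos, of "U x" x] this[OF w_pos, of "V x" x] show ?thesis
      unfolding doob_def using Q_ge_1 by (intro mult_left_mono) auto
  qed
  ultimately show ?thesis by (simp add: corona_def algebra_simps)
qed

text \<open>Adding \<open>d * s\<close> to \<open>U\<close> (that is, \<open>d\<close> times the dual weight to \<open>\<bar>f1\<bar>\<close>) makes it positive without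
  leaving the class, since \<open>\<sigma>\<^sup>2 w = \<sigma>\<close>.\<close>

lemma perturb:
  assumes "0 < d" "0 < t"
  shows "weighted_tree l r (\<lambda>x. t * F x) (\<lambda>x. G x / t) (\<lambda>x. t * U x + d * s x) (\<lambda>x. V x / t + d * w x)
    (\<lambda>x. t\<^sup>2 * A x + 2 * d * t * U x + d\<^sup>2 * s x) (\<lambda>x. B x / t\<^sup>2 + 2 * d * V x / t + d\<^sup>2 * w x) w s Q"
proof
  fix x
  show "t * F x = (t * F (l x) + t * F (r x)) / 2" "G x / t = (G (l x) / t + G (r x) / t) / 2"
    by (simp_all add: F_mean[of x] G_mean[of x] add_divide_distrib ring_distribs)
  show "t * U x + d * s x = (t * U (l x) + d * s (l x) + (t * U (r x) + d * s (r x))) / 2"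
    "V x / t + d * w x = (V (l x) / t + d * w (l x) + (V (r x) / t + d * w (r x))) / 2"
    by (simp_all add: U_mean[of x] V_mean[of x] s_mean[of x] w_mean[of x] add_divide_distrib ring_distribs)
  show "t\<^sup>2 * A x + 2 * d * t * U x + d\<^sup>2 * s x =
     (t\<^sup>2 * A (l x) + 2 * d * t * U (l x) + d\<^sup>2 * s (l x) + (t\<^sup>2 * A (r x) + 2 * d * t * U (r x) + d\<^sup>2 * s (r x))) / 2"
    "B x / t\<^sup>2 + 2 * d * V x / t + d\<^sup>2 * w x =
     (B (l x) / t\<^sup>2 + 2 * d * V (l x) / t + d\<^sup>2 * w (l x) + (B (r x) / t\<^sup>2 + 2 * d * V (r x) / t + d\<^sup>2 * w (r x))) / 2"
    by (simp_all add: U_mean[of x] V_mean[of x] A_mean[of x] B_mean[of x] s_mean[of x] w_mean[of x]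
        add_divide_distrib ring_distribs)
  show "w x = (w (l x) + w (r x)) / 2" "s x = (s (l x) + s (r x)) / 2" by (fact w_mean s_mean)+
  show "\<bar>t * F x\<bar> \<le> t * U x + d * s x"
    using F_le[of x] s_pos[of x] assms by (simp add: abs_mult add_increasing2 mult_left_mono)
  show "\<bar>G x / t\<bar> \<le> V x / t + d * w x"
    using G_le[of x] w_pos[of x] assms by (simp add: abs_divide add_increasing2 divide_right_mono)
  have "t\<^sup>2 * (U x)\<^sup>2 \<le> t\<^sup>2 * (A x * s x)" using U_le[of x] by (intro mult_left_mono) auto
  then show "(t * U x + d * s x)\<^sup>2 \<le> (t\<^sup>2 * A x + 2 * d * t * U x + d\<^sup>2 * s x) * s x"
    by (simp add: power2_eq_square algebra_simps)
  have "(V x)\<^sup>2 / t\<^sup>2 \<le> B x * w x / t\<^sup>2" using V_le[of x] by (intro divide_right_mono) auto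
  then show "(V x / t + d * w x)\<^sup>2 \<le> (B x / t\<^sup>2 + 2 * d * V x / t + d\<^sup>2 * w x) * w x"
    by (simp add: power2_eq_square algebra_simps)
  show "0 < w x" "0 < s x" "1 \<le> w x * s x" "w x * s x \<le> Q"
    by (fact w_pos s_pos ws_ge ws_le)+
qed

text \<open>For \<open>d > 0\<close> the perturbed tree satisfies the positivity assumptions, and
  \<open>d\<close> tends to 0. The parameter \<open>t\<close> comes from the scale invariance of
  \<open>shift_sum\<close>.\<close>

lemma shift_sum_le_scaled:
  assumes "0 < t"
  shows "shift_sum l r F G n 0 x \<le> 384 * Q * (t\<^sup>2 * A x + B x / t\<^sup>2)"
proof (rule tendsto_lowerbound)
  let ?f = "\<lambda>d. 384 * Q * ((t\<^sup>2 * A x + 2 * d * t * U x + d\<^sup>2 * s x)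
              + (B x / t\<^sup>2 + 2 * d * V x / t + d\<^sup>2 * w x))"
  have "(?f \<longlongrightarrow> ?f 0) (at_right 0)"
    using assms by (intro tendsto_intros) auto
  then show "(?f \<longlongrightarrow> 384 * Q * (t\<^sup>2 * A x + B x / t\<^sup>2)) (at_right 0)" by simp
  show "\<forall>\<^sub>F d in at_right 0. shift_sum l r F G n 0 x \<le> ?f d"
  proof (rule eventually_at_right_less[of 0, THEN eventually_mono])
    fix d :: real assume d: "0 < d"
    interpret p: weighted_tree l r "\<lambda>x. t * F x" "\<lambda>x. G x / t"
      "\<lambda>x. t * U x + d * s x" "\<lambda>x. V x / t + d * w x"
      "\<lambda>x. t\<^sup>2 * A x + 2 * d * t * U x + d\<^sup>2 * s x" "\<lambda>x. B x / t\<^sup>2 + 2 * d * V x / t + d\<^sup>2 * w x" w s Q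
      using d assms by (rule perturb)
    have "0 \<le> U x" "0 \<le> V x" for x using F_le[of x] G_le[of x] by linarith+
    then have "shift_sum l r (\<lambda>x. t * F x) (\<lambda>x. G x / t) n 0 x \<le> ?f d"
      using d assms s_pos w_pos by (intro p.shift_sum_le_positive add_nonneg_pos) auto
    then show "shift_sum l r F G n 0 x \<le> ?f d"
      using shift_sum_scale[OF assms, of l r F G n 0 x] by simp
  qed
qed simp

text \<open>Optimisation over \<open>t\<close> turns the sum into a geometric mean. As
  \<open>A x\<close> or \<open>B x\<close> may vanish, both are first raised by
  \<open>d\<close>.\<close>

lemma shift_sum_le: "shift_sum l r F G n 0 x \<le> 768 * Q * sqrt (A x * B x)"
proof (rule tendsto_lowerbound)
  have A: "0 \<le> A x" and B: "0 \<le> B x"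
    using U_le[of x] V_le[of x] s_pos[of x] w_pos[of x]
    by (smt (verit) mult_less_0_iff zero_le_power2)+
  let ?f = "\<lambda>d. 768 * Q * sqrt ((A x + d) * (B x + d))"
  have "(?f \<longlongrightarrow> ?f 0) (at_right 0)" by (intro tendsto_intros)
  then show "(?f \<longlongrightarrow> 768 * Q * sqrt (A x * B x)) (at_right 0)" by simp
  show "\<forall>\<^sub>F d in at_right 0. shift_sum l r F G n 0 x \<le> ?f d"
  proof (rule eventually_at_right_less[of 0, THEN eventually_mono])
    fix d :: real assume d: "0 < d"
    define u v where "u = sqrt (A x + d)" and "v = sqrt (B x + d)"
    have uv: "0 < u" "0 < v" "u\<^sup>2 = A x + d" "v\<^sup>2 = B x + d"
      using A B d by (simp_all add: u_def v_def)
    \<comment> \<open>This choice makes \<open>t\<^sup>2 * u\<^sup>2\<close> and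
      \<open>v\<^sup>2 / t\<^sup>2\<close> both equal to \<open>u * v\<close>, so 384 doubles to
      768.\<close>
    define t where "t = sqrt (v / u)"
    have t: "0 < t" "t\<^sup>2 = v / u" using uv by (simp_all add: t_def)
    have "t\<^sup>2 * A x + B x / t\<^sup>2 \<le> t\<^sup>2 * u\<^sup>2 + v\<^sup>2 / t\<^sup>2"
      using d t uv by (intro add_mono mult_left_mono divide_right_mono) auto
    also have "\<dots> = 2 * (u * v)"
      unfolding t(2) using uv(1,2) by (simp add: power2_eq_square)
    finally have "384 * Q * (t\<^sup>2 * A x + B x / t\<^sup>2) \<le> 384 * Q * (2 * (u * v))"
      using Q_ge_1 by (intro mult_left_mono) auto
    also have "\<dots> = ?f d" by (simp add: u_def v_def real_sqrt_mult)
    finally show "shift_sum l r F G n 0 x \<le> ?f d"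
      using shift_sum_le_scaled[OF t(1), of n x] by linarith
  qed
qed simp

end
section \<open>The tree of dyadic intervals\<close>

text \<open>Coding an interval by exponent and index turns the tree operations into integer
  arithmetic; floor division finds the parent for negative indices too.\<close>

definition dyadic :: "int \<times> int \<Rightarrow> real set" where
  "dyadic x = {of_int (snd x) * 2 powi fst x ..< (of_int (snd x) + 1) * 2 powi fst x}"

definition lchild :: "int \<times> int \<Rightarrow> int \<times> int" where
  "lchild x = (fst x - 1, 2 * snd x)"

definition rchild :: "int \<times> int \<Rightarrow> int \<times> int" where
  "rchild x = (fst x - 1, 2 * snd x + 1)"

definition parent :: "int \<times> int \<Rightarrow> int \<times> int" where
  "parent x = (fst x + 1, snd x div 2)"

lemma parent_child [simp]: "parent (lchild x) = x" "parent (rchild x) = x"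
  by (simp_all add: parent_def lchild_def rchild_def)

lemma child_parent: "lchild (parent x) = x \<or> rchild (parent x) = x"
  by (cases x) (auto simp: parent_def lchild_def rchild_def)

lemma dyadic_intervals_eq: "dyadic_intervals = range dyadic"
  by (force simp: dyadic_intervals_def dyadic_def image_def)

lemma powi_two_diff_one: "(2::real) powi (m - 1) = 2 powi m / 2"
  by (simp add: power_int_diff)

lemma powi_two_add_one: "(2::real) powi (m + 1) = 2 * 2 powi m"
  by (simp add: power_int_add)

lemma dyadic_nonempty: "of_int (snd x) * 2 powi fst x < (of_int (snd x) + 1) * (2::real) powi fst x"
  by (simp add: distrib_right)

lemma left_half_dyadic: "left_half (dyadic x) = dyadic (lchild x)"
  using dyadic_nonempty[of x]
  by (simp add: dyadic_def left_half_interval lchild_def powi_two_diff_one algebra_simps)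

lemma right_half_dyadic: "right_half (dyadic x) = dyadic (rchild x)"
  using dyadic_nonempty[of x]
  by (simp add: dyadic_def right_half_interval rchild_def powi_two_diff_one algebra_simps)

lemma measure_dyadic: "measure lebesgue (dyadic x) = 2 powi fst x"
  using dyadic_nonempty[of x] by (simp add: dyadic_def distrib_right)

lemma measure_dyadic_pos: "0 < measure lebesgue (dyadic x)"
  by (simp add: measure_dyadic)

lemma measure_dyadic_child:
  "measure lebesgue (dyadic (lchild x)) = measure lebesgue (dyadic x) / 2"
  "measure lebesgue (dyadic (rchild x)) = measure lebesgue (dyadic x) / 2"
  by (simp_all add: measure_dyadic lchild_def rchild_def powi_two_diff_one)

lemma dyadic_sets [measurable, simp]: "dyadic x \<in> sets lebesgue"
  by (simp add: dyadic_def)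

lemma dyadic_split:
  "dyadic x = dyadic (lchild x) \<union> dyadic (rchild x)" "dyadic (lchild x) \<inter> dyadic (rchild x) = {}"
proof -
  define p :: real where "p = 2 powi fst x"
  define k :: real where "k = of_int (snd x)"
  have "0 < p" by (simp add: p_def)
  then have "k * p \<le> (2 * k + 1) * (p / 2)" "(2 * k + 1) * (p / 2) \<le> (k + 1) * p"
    by (simp_all add: field_simps)
  moreover have "dyadic x = {k * p..<(k + 1) * p}"
      "dyadic (lchild x) = {k * p..<(2 * k + 1) * (p / 2)}"
      "dyadic (rchild x) = {(2 * k + 1) * (p / 2)..<(k + 1) * p}"
    by (simp_all add: dyadic_def lchild_def rchild_def p_def k_def powi_two_diff_one algebra_simps)
  ultimately show "dyadic x = dyadic (lchild x) \<union> dyadic (rchild x)"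
    "dyadic (lchild x) \<inter> dyadic (rchild x) = {}"
    by auto
qed

text \<open>The lengths fix the scales. The left endpoint of the smaller interval lies in the larger
  one, so its index is \<open>2 * k\<close> or \<open>2 * k + 1\<close>. Pairs can thus be indexed
  by the smaller interval alone.\<close>

lemma child_pairs_subset: "child_pairs \<subseteq> range (\<lambda>y. (dyadic (parent y), dyadic y))"
proof
  fix p assume "p \<in> child_pairs"
  then obtain I J where p: "p = (dyadic I, dyadic J)" and sub: "dyadic J \<subseteq> dyadic I"
    and meas: "measure lebesgue (dyadic J) = measure lebesgue (dyadic I) / 2"
    by (auto simp: child_pairs_def dyadic_intervals_eq)
  have "(2::real) powi fst J = 2 powi (fst I - 1)"
    using meas by (simp add: measure_dyadic powi_two_diff_one)
  then have m: "fst I = fst J + 1"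
    using power_int_strict_increasing[of "fst J" "fst I - 1" "2::real"]
      power_int_strict_increasing[of "fst I - 1" "fst J" "2::real"]
    by linarith
  have "of_int (snd J) * 2 powi fst J \<in> dyadic J"
    using dyadic_nonempty[of J] by (simp add: dyadic_def)
  then have "of_int (snd J) * 2 powi fst J \<in> dyadic I"
    using sub by blast
  moreover have "(2::real) powi fst I = 2 * 2 powi fst J"
    unfolding m by (rule powi_two_add_one)
  ultimately have "(2 * of_int (snd I)) * (2::real) powi fst J \<le> of_int (snd J) * 2 powi fst J"
    "of_int (snd J) * (2::real) powi fst J < (2 * of_int (snd I) + 2) * 2 powi fst J"
    by (simp_all add: dyadic_def algebra_simps)
  then have "2 * real_of_int (snd I) \<le> of_int (snd J)" "real_of_int (snd J) < 2 * of_int (snd I) + 2"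
    by (simp_all add: mult_le_cancel_right_pos mult_less_cancel_right_pos)
  then have "snd I = snd J div 2" by linarith
  then have "I = parent J" using m by (simp add: parent_def prod_eq_iff)
  then show "p \<in> range (\<lambda>y. (dyadic (parent y), dyadic y))" using p by blast
qed

section \<open>Averages and Haar coefficients\<close>

lemma set_integral_dyadic_split:
  fixes f :: "real \<Rightarrow> real"
  assumes "set_integrable lebesgue (dyadic x) f"
  shows "(LINT t:dyadic x|lebesgue. f t) =
    (LINT t:dyadic (lchild x)|lebesgue. f t) + (LINT t:dyadic (rchild x)|lebesgue. f t)"
proof -
  have "set_integrable lebesgue (dyadic (lchild x)) f"
    "set_integrable lebesgue (dyadic (rchild x)) f"
    using dyadic_split(1)[of x] by (auto intro: set_integrable_subset[OF assms dyadic_sets])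
  then show ?thesis
    using dyadic_split[of x] by (simp add: set_integral_Un)
qed

lemma avg_dyadic_mean:
  assumes "set_integrable lebesgue (dyadic x) f"
  shows "avg f (dyadic x) = (avg f (dyadic (lchild x)) + avg f (dyadic (rchild x))) / 2"
  unfolding avg_def set_integral_dyadic_split[OF assms] measure_dyadic_child
  by (simp add: add_divide_distrib)

text \<open>The halves have length \<open>p / 2\<close>, so their integrals differ by
  \<open>p\<close> times the jump of the averages; the normalisation \<open>p powr (-1/2)\<close>
  leaves \<open>sqrt p\<close>.\<close>

lemma haar_coeff_dyadic:
  assumes "set_integrable lebesgue (dyadic x) f"
  shows "haar_coeff f (dyadic x) =
    sqrt (2 powi fst x) * jump lchild rchild (\<lambda>y. avg f (dyadic y)) x"
proof -
  define p :: real where "p = 2 powi fst x"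
  have p: "0 < p" by (simp add: p_def)
  have meas: "measure lebesgue (dyadic (lchild x)) = p / 2"
    "measure lebesgue (dyadic (rchild x)) = p / 2"
    unfolding measure_dyadic_child by (simp_all add: measure_dyadic p_def)
  have int: "set_integrable lebesgue (dyadic (lchild x)) f"
    "set_integrable lebesgue (dyadic (rchild x)) f"
    using dyadic_split(1)[of x] by (auto intro: set_integrable_subset[OF assms dyadic_sets])
  have "haar_coeff f (dyadic x) = (\<integral>t. p powr (-1/2) * (indicator (dyadic (rchild x)) t *\<^sub>R f t
      - indicator (dyadic (lchild x)) t *\<^sub>R f t) \<partial>lebesgue)"
    unfolding haar_coeff_def haar_def left_half_dyadic right_half_dyadic measure_dyadic p_def
    by (intro Bochner_Integration.integral_cong) (simp_all add: algebra_simps)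
  also have "\<dots> = p powr (-1/2) *
      ((LINT t:dyadic (rchild x)|lebesgue. f t) - (LINT t:dyadic (lchild x)|lebesgue. f t))"
    using int by (simp add: set_integrable_def set_lebesgue_integral_def)
  also have "\<dots> = p powr (-1/2) * (p * jump lchild rchild (\<lambda>y. avg f (dyadic y)) x)"
    using p by (simp add: jump_def avg_def meas field_simps)
  also have "\<dots> = sqrt p * jump lchild rchild (\<lambda>y. avg f (dyadic y)) x"
  proof -
    have "p powr (-1/2) * p = sqrt p"
      using powr_add[of p "-1/2" 1] p by (simp add: powr_half_sqrt)
    then show ?thesis by (simp flip: mult.assoc)
  qed
  finally show ?thesis by (simp add: p_def)
qed

section \<open>Weighted Cauchy-Schwarz on dyadic intervals\<close>

text \<open>For \<open>a > 0\<close> take \<open>t = u / a\<close>; for \<open>a = 0\<close> a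
  linear function of \<open>t\<close> that is bounded above vanishes.\<close>

lemma square_le_mult_of_quadratic:
  fixes u a b :: real
  assumes "\<And>t. 2 * t * u \<le> t\<^sup>2 * a + b" "0 \<le> a"
  shows "u\<^sup>2 \<le> a * b"
proof (cases "a = 0")
  case True
  have "u = 0"
  proof (rule ccontr)
    assume "u \<noteq> 0"
    then show False using assms(1)[of "(\<bar>b\<bar> + 1) / u"] True by simp
  qed
  then show ?thesis by (simp add: True)
next
  case False
  then show ?thesis
    using assms(1)[of "u / a"] assms(2) by (simp add: power2_eq_square field_simps)
qed

lemma avg_nonneg: "(\<And>t. 0 \<le> f t) \<Longrightarrow> 0 \<le> avg f I"
  unfolding avg_def set_lebesgue_integral_def
  by (intro divide_nonneg_nonneg Bochner_Integration.integral_nonneg) auto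

lemma measure_avg_le:
  assumes "integrable lebesgue f" "\<And>t. 0 \<le> f t"
  shows "2 powi fst x * avg f (dyadic x) \<le> (\<integral>t. f t \<partial>lebesgue)"
proof -
  have "(LINT t:dyadic x|lebesgue. f t) \<le> (\<integral>t. f t \<partial>lebesgue)"
    unfolding set_lebesgue_integral_def
    using assms by (intro integral_mono integrable_mult_indicator) (auto simp: indicator_def)
  then show ?thesis by (simp add: avg_def measure_dyadic)
qed

text \<open>Where \<open>w t * s t = 1\<close>, expanding the square of
  \<open>a * \<bar>f t\<bar> * w t - 1\<close> bounds \<open>2 * a * \<bar>f t\<bar>\<close> by
  \<open>a\<^sup>2 * (\<bar>f t\<bar>\<^sup>2 * w t) + s t\<close>. The case \<open>a = 1\<close>
  gives integrability; integrating for all \<open>a\<close> gives the inequality.\<close>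

lemma avg_Cauchy_Schwarz:
  fixes f w s :: "real \<Rightarrow> real"
  assumes f: "f \<in> borel_measurable lebesgue"
    and nonneg: "\<And>t. 0 \<le> w t" "\<And>t. 0 \<le> s t" and ws: "AE t in lebesgue. w t * s t = 1"
    and s: "set_integrable lebesgue (dyadic x) s"
    and fw: "set_integrable lebesgue (dyadic x) (\<lambda>t. \<bar>f t\<bar>\<^sup>2 * w t)"
  shows "set_integrable lebesgue (dyadic x) f"
    and "(avg (\<lambda>t. \<bar>f t\<bar>) (dyadic x))\<^sup>2 \<le> avg (\<lambda>t. \<bar>f t\<bar>\<^sup>2 * w t) (dyadic x) * avg s (dyadic x)"
proof -
  let ?I = "dyadic x"
  have le: "AE t in lebesgue. 2 * a * \<bar>f t\<bar> \<le> a\<^sup>2 * (\<bar>f t\<bar>\<^sup>2 * w t) + s t" for a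
    using ws
  proof (rule AE_mp, intro AE_I2 impI)
    fix t assume 1: "w t * s t = 1"
    have "0 < w t" using nonneg[of t] 1 by (cases "w t = 0") auto
    have "0 \<le> (a * \<bar>f t\<bar> * w t - 1)\<^sup>2" by simp
    also have "\<dots> = a\<^sup>2 * \<bar>f t\<bar>\<^sup>2 * w t * w t - 2 * a * \<bar>f t\<bar> * w t + w t * s t"
      using 1 by (simp add: power2_eq_square algebra_simps)
    also have "\<dots> = w t * (a\<^sup>2 * (\<bar>f t\<bar>\<^sup>2 * w t) + s t - 2 * a * \<bar>f t\<bar>)"
      by (simp add: algebra_simps)
    finally show "2 * a * \<bar>f t\<bar> \<le> a\<^sup>2 * (\<bar>f t\<bar>\<^sup>2 * w t) + s t"
      using \<open>0 < w t\<close> by (simp add: zero_le_mult_iff)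
  qed
  have bound: "set_integrable lebesgue ?I (\<lambda>t. a * (\<bar>f t\<bar>\<^sup>2 * w t) + s t)" for a
    using s fw by (intro set_integral_add set_integrable_mult_right)
  show int: "set_integrable lebesgue ?I f"
    unfolding set_integrable_def
  proof (rule Bochner_Integration.integrable_bound[OF bound[of 1, unfolded set_integrable_def]])
    show "(\<lambda>t. indicator ?I t *\<^sub>R f t) \<in> borel_measurable lebesgue"
      using f by measurable
    show "AE t in lebesgue. norm (indicator ?I t *\<^sub>R f t)
        \<le> norm (indicator ?I t *\<^sub>R (1 * (\<bar>f t\<bar>\<^sup>2 * w t) + s t))"
      using le[of 1]
    proof (rule AE_mp, intro AE_I2 impI)
      fix t assume "2 * 1 * \<bar>f t\<bar> \<le> 1\<^sup>2 * (\<bar>f t\<bar>\<^sup>2 * w t) + s t"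
      then have "\<bar>f t\<bar> \<le> \<bar>f t\<bar>\<^sup>2 * w t + s t"
        unfolding one_power2 mult_1 mult_1_right using abs_ge_zero[of "f t"] by linarith
      then show "norm (indicator ?I t *\<^sub>R f t)
          \<le> norm (indicator ?I t *\<^sub>R (1 * (\<bar>f t\<bar>\<^sup>2 * w t) + s t))"
        using nonneg[of t] by (simp add: indicator_def)
    qed
  qed
  show "(avg (\<lambda>t. \<bar>f t\<bar>) ?I)\<^sup>2 \<le> avg (\<lambda>t. \<bar>f t\<bar>\<^sup>2 * w t) ?I * avg s ?I"
  proof (rule square_le_mult_of_quadratic)
    fix a :: real
    have abs: "set_integrable lebesgue ?I (\<lambda>t. \<bar>f t\<bar>)"
      using int by (rule set_integrable_abs)
    have "(LINT t:?I|lebesgue. 2 * a * \<bar>f t\<bar>) \<le> (LINT t:?I|lebesgue. a\<^sup>2 * (\<bar>f t\<bar>\<^sup>2 * w t) + s t)"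
      unfolding set_lebesgue_integral_def
    proof (rule integral_mono_AE)
      show "integrable lebesgue (\<lambda>t. indicator ?I t *\<^sub>R (2 * a * \<bar>f t\<bar>))"
        using set_integrable_mult_right[of "2 * a", OF abs] by (simp add: set_integrable_def)
      show "integrable lebesgue (\<lambda>t. indicator ?I t *\<^sub>R (a\<^sup>2 * (\<bar>f t\<bar>\<^sup>2 * w t) + s t))"
        using bound by (simp add: set_integrable_def)
      show "AE t in lebesgue. indicator ?I t *\<^sub>R (2 * a * \<bar>f t\<bar>)
          \<le> indicator ?I t *\<^sub>R (a\<^sup>2 * (\<bar>f t\<bar>\<^sup>2 * w t) + s t)"
        using le[of a] by (rule AE_mp) (auto simp: indicator_def)
    qed
    also have "\<dots> = a\<^sup>2 * (LINT t:?I|lebesgue. \<bar>f t\<bar>\<^sup>2 * w t) + (LINT t:?I|lebesgue. s t)"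
      using s fw by (subst set_integral_add) (auto intro!: set_integrable_mult_right)
    finally have "2 * a * (LINT t:?I|lebesgue. \<bar>f t\<bar>)
        \<le> a\<^sup>2 * (LINT t:?I|lebesgue. \<bar>f t\<bar>\<^sup>2 * w t) + (LINT t:?I|lebesgue. s t)"
      by simp
    then show "2 * a * avg (\<lambda>t. \<bar>f t\<bar>) ?I \<le> a\<^sup>2 * avg (\<lambda>t. \<bar>f t\<bar>\<^sup>2 * w t) ?I + avg s ?I"
      using measure_dyadic_pos[of x] unfolding avg_def by (simp add: field_simps)
  next
    show "0 \<le> avg (\<lambda>t. \<bar>f t\<bar>\<^sup>2 * w t) ?I"
      using nonneg by (intro avg_nonneg) simp
  qed
qed

lemma abs_avg_le:
  assumes "set_integrable lebesgue (dyadic x) f"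
  shows "\<bar>avg f (dyadic x)\<bar> \<le> avg (\<lambda>t. \<bar>f t\<bar>) (dyadic x)"
proof -
  have "\<bar>LINT t:dyadic x|lebesgue. f t\<bar> \<le> (LINT t:dyadic x|lebesgue. \<bar>f t\<bar>)"
    using integral_norm_bound[of lebesgue "\<lambda>t. indicator (dyadic x) t *\<^sub>R f t"]
    by (simp add: set_lebesgue_integral_def abs_mult)
  then show ?thesis
    by (simp add: avg_def abs_divide divide_right_mono)
qed

lemma locally_integrable_dyadic:
  assumes "locally_integrable f"
  shows "set_integrable lebesgue (dyadic x) f"
proof -
  have "set_integrable lebesgue {of_int (snd x) * 2 powi fst x .. (of_int (snd x) + 1) * 2 powi fst x} f"
    using assms by (simp add: locally_integrable_def)
  then show ?thesis
    by (rule set_integrable_subset) (auto simp: dyadic_def)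
qed

lemma avg_const_one: "avg (\<lambda>_. 1) (dyadic x) = 1"
  using measure_dyadic_pos[of x]
  by (simp add: avg_def set_lebesgue_integral_def)

lemma weighted_tree_dyadic:
  assumes A2: "A2_weight w" and f1: "in_L2 w f1" and f2: "in_L2 (dual_weight w) f2"
  shows "weighted_tree lchild rchild (\<lambda>x. avg f1 (dyadic x)) (\<lambda>x. avg f2 (dyadic x))
    (\<lambda>x. avg (\<lambda>t. \<bar>f1 t\<bar>) (dyadic x)) (\<lambda>x. avg (\<lambda>t. \<bar>f2 t\<bar>) (dyadic x))
    (\<lambda>x. avg (\<lambda>t. \<bar>f1 t\<bar>\<^sup>2 * w t) (dyadic x)) (\<lambda>x. avg (\<lambda>t. \<bar>f2 t\<bar>\<^sup>2 * dual_weight w t) (dyadic x))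
    (\<lambda>x. avg w (dyadic x)) (\<lambda>x. avg (dual_weight w) (dyadic x)) (A2_char w)"
    and "set_integrable lebesgue (dyadic x) f1" and "set_integrable lebesgue (dyadic x) f2"
proof -
  define s where "s = dual_weight w"
  have nonneg: "0 \<le> w t" "0 \<le> s t" for t
    using A2 by (auto simp: A2_weight_def s_def dual_weight_def)
  have "AE t in lebesgue. 0 < w t" using A2 by (simp add: A2_weight_def)
  then have ws: "AE t in lebesgue. w t * s t = 1"
    by eventually_elim (simp add: s_def dual_weight_def)
  then have sw: "AE t in lebesgue. s t * w t = 1"
    by eventually_elim (simp add: mult.commute)
  have int: "set_integrable lebesgue (dyadic x) w" "set_integrable lebesgue (dyadic x) s" for x
    using A2 by (auto simp: A2_weight_def s_def intro: locally_integrable_dyadic)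
  have int2: "set_integrable lebesgue (dyadic x) (\<lambda>t. \<bar>f1 t\<bar>\<^sup>2 * w t)"
    "set_integrable lebesgue (dyadic x) (\<lambda>t. \<bar>f2 t\<bar>\<^sup>2 * s t)" for x
    unfolding set_integrable_def using f1 f2
    by (intro integrable_mult_indicator dyadic_sets; simp add: in_L2_def s_def)+
  have meas: "f1 \<in> borel_measurable lebesgue" "f2 \<in> borel_measurable lebesgue"
    using f1 f2 by (auto simp: in_L2_def)
  note CS1 = avg_Cauchy_Schwarz[OF meas(1) nonneg ws int(2) int2(1)]
  note CS2 = avg_Cauchy_Schwarz[OF meas(2) nonneg(2,1) sw int(1) int2(2)]
  show "set_integrable lebesgue (dyadic x) f1" "set_integrable lebesgue (dyadic x) f2"
    by (fact CS1(1) CS2(1))+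
  \<comment> \<open>Cauchy-Schwarz for the constant function 1.\<close>
  have prod: "1 \<le> avg w (dyadic x) * avg s (dyadic x)" for x
    using avg_Cauchy_Schwarz(2)[of "\<lambda>_. 1", OF _ nonneg ws int(2)] int(1)
    by (simp add: avg_const_one)
  have pos: "0 < avg w (dyadic x)" "0 < avg s (dyadic x)" for x
    using prod[of x] avg_nonneg[of w "dyadic x"] avg_nonneg[of s "dyadic x"] nonneg
    by (auto simp: less_le)
  have le: "avg w (dyadic x) * avg s (dyadic x) \<le> A2_char w" for x
    using A2 unfolding A2_char_def A2_weight_def s_def
    by (intro cSUP_upper) (auto simp: dyadic_intervals_eq)
  show "weighted_tree lchild rchild (\<lambda>x. avg f1 (dyadic x)) (\<lambda>x. avg f2 (dyadic x))
    (\<lambda>x. avg (\<lambda>t. \<bar>f1 t\<bar>) (dyadic x)) (\<lambda>x. avg (\<lambda>t. \<bar>f2 t\<bar>) (dyadic x))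
    (\<lambda>x. avg (\<lambda>t. \<bar>f1 t\<bar>\<^sup>2 * w t) (dyadic x)) (\<lambda>x. avg (\<lambda>t. \<bar>f2 t\<bar>\<^sup>2 * dual_weight w t) (dyadic x))
    (\<lambda>x. avg w (dyadic x)) (\<lambda>x. avg (dual_weight w) (dyadic x)) (A2_char w)"
    unfolding s_def[symmetric]
  proof (rule weighted_tree.intro)
    fix x
    show "avg f1 (dyadic x) = (avg f1 (dyadic (lchild x)) + avg f1 (dyadic (rchild x))) / 2"
      "avg f2 (dyadic x) = (avg f2 (dyadic (lchild x)) + avg f2 (dyadic (rchild x))) / 2"
      by (fact avg_dyadic_mean[OF CS1(1)] avg_dyadic_mean[OF CS2(1)])+
    show "avg (\<lambda>t. \<bar>f1 t\<bar>) (dyadic x) =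
        (avg (\<lambda>t. \<bar>f1 t\<bar>) (dyadic (lchild x)) + avg (\<lambda>t. \<bar>f1 t\<bar>) (dyadic (rchild x))) / 2"
      "avg (\<lambda>t. \<bar>f2 t\<bar>) (dyadic x) =
        (avg (\<lambda>t. \<bar>f2 t\<bar>) (dyadic (lchild x)) + avg (\<lambda>t. \<bar>f2 t\<bar>) (dyadic (rchild x))) / 2"
      by (fact avg_dyadic_mean[OF set_integrable_abs[OF CS1(1)]]
          avg_dyadic_mean[OF set_integrable_abs[OF CS2(1)]])+
  qed (fact avg_dyadic_mean[OF int2(1)] avg_dyadic_mean[OF int2(2)]
      avg_dyadic_mean[OF int(1)] avg_dyadic_mean[OF int(2)]
      abs_avg_le[OF CS1(1)] abs_avg_le[OF CS2(1)] CS1(2) CS2(2) pos prod le)+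
qed

section \<open>Summation over pairs\<close>

lemma sum_union_le:
  fixes f :: "'a \<Rightarrow> real"
  assumes "finite A" "finite B" "\<And>x. 0 \<le> f x"
  shows "sum f (A \<union> B) \<le> sum f A + sum f B"
  using assms by (simp add: sum_Un sum_nonneg)

text \<open>\<open>snd y div 2 ^ d\<close> is the index of the ancestor \<open>d\<close> generations
  up, so these are the first \<open>n\<close> generations, starting with \<open>x\<close>
  itself.\<close>

definition descendants :: "nat \<Rightarrow> int \<times> int \<Rightarrow> (int \<times> int) set" where
  "descendants n x = {y. \<exists>d<n. fst y = fst x - int d \<and> snd y div 2 ^ d = snd x}"

lemma descendants_Suc:
  "descendants (Suc n) x \<subseteq> insert x (descendants n (lchild x) \<union> descendants n (rchild x))"
proof
  fix y assume "y \<in> descendants (Suc n) x"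
  then obtain d where d: "d < Suc n" "fst y = fst x - int d" "snd y div 2 ^ d = snd x"
    by (auto simp: descendants_def)
  show "y \<in> insert x (descendants n (lchild x) \<union> descendants n (rchild x))"
  proof (cases d)
    case 0
    then show ?thesis using d by (simp add: prod_eq_iff)
  next
    case (Suc e)
    have "(snd y div 2 ^ e) div 2 = snd x"
      using d Suc by (simp add: zdiv_zmult2_eq[symmetric] mult.commute)
    then have "snd y div 2 ^ e = 2 * snd x \<or> snd y div 2 ^ e = 2 * snd x + 1" by linarith
    then show ?thesis
      using d Suc by (auto simp: descendants_def lchild_def rchild_def)
  qed
qed

lemma finite_descendants: "finite (descendants n x)"
proof (induction n arbitrary: x)
  case (Suc n)
  show ?case
    by (rule finite_subset[OF descendants_Suc]) (simp add: Suc)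
qed (simp add: descendants_def)

text \<open>The factor \<open>2 powi fst y\<close> halves with each generation, which matches the
  averaging in \<open>shift_sum\<close>.\<close>

lemma sum_descendants_le:
  fixes F G :: "int \<times> int \<Rightarrow> real"
  defines "dF \<equiv> jump lchild rchild F" and "dG \<equiv> jump lchild rchild G"
  shows "(\<Sum>y\<in>descendants n x. 2 powi fst y * (\<bar>dF (parent y)\<bar> * \<bar>dG y\<bar>))
    \<le> 2 powi fst x * shift_sum lchild rchild F G n (\<bar>dF (parent x)\<bar>) x"
proof (induction n arbitrary: x)
  case (Suc n)
  let ?t = "\<lambda>y. 2 powi fst y * (\<bar>dF (parent y)\<bar> * \<bar>dG y\<bar>)"
  have "sum ?t (descendants (Suc n) x)
      \<le> sum ?t (insert x (descendants n (lchild x) \<union> descendants n (rchild x)))"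
    by (intro sum_mono2 descendants_Suc) (auto simp: finite_descendants)
  also have "\<dots> \<le> ?t x + sum ?t (descendants n (lchild x) \<union> descendants n (rchild x))"
    by (subst sum.insert_if) (auto simp: finite_descendants)
  also have "\<dots> \<le> ?t x + (sum ?t (descendants n (lchild x)) + sum ?t (descendants n (rchild x)))"
    by (intro add_left_mono sum_union_le) (auto simp: finite_descendants)
  also have "\<dots> \<le> ?t x
      + (2 powi fst (lchild x) * shift_sum lchild rchild F G n (\<bar>dF (parent (lchild x))\<bar>) (lchild x)
      + 2 powi fst (rchild x) * shift_sum lchild rchild F G n (\<bar>dF (parent (rchild x))\<bar>) (rchild x))"
    by (intro add_left_mono add_mono Suc)
  also have "\<dots> = 2 powi fst x * shift_sum lchild rchild F G (Suc n) (\<bar>dF (parent x)\<bar>) x"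
    by (simp add: dF_def dG_def)
       (simp add: lchild_def rchild_def powi_two_diff_one field_simps)
  finally show ?case .
qed (simp add: descendants_def)

text \<open>\<open>shift_sum_le\<close> has no carried jump, so the recursion starts one generation
  higher; the sibling only adds a nonnegative amount.\<close>

lemma sum_descendants_le_parent:
  fixes F G :: "int \<times> int \<Rightarrow> real"
  defines "dF \<equiv> jump lchild rchild F" and "dG \<equiv> jump lchild rchild G"
  shows "(\<Sum>y\<in>descendants n x. 2 powi fst y * (\<bar>dF (parent y)\<bar> * \<bar>dG y\<bar>))
    \<le> 2 powi fst (parent x) * shift_sum lchild rchild F G (Suc n) 0 (parent x)"
proof -
  let ?S = "shift_sum lchild rchild F G n \<bar>dF (parent x)\<bar>"
  have "?S x \<le> ?S (lchild (parent x)) + ?S (rchild (parent x))"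
    using child_parent[of x] shift_sum_nonneg[of "\<bar>dF (parent x)\<bar>" lchild rchild F G n]
    by (metis abs_ge_zero le_add_same_cancel1 le_add_same_cancel2)
  then have "2 powi fst x * ?S x \<le> 2 powi fst x * (?S (lchild (parent x)) + ?S (rchild (parent x)))"
    by (intro mult_left_mono) auto
  also have "\<dots> = 2 powi fst (parent x) * shift_sum lchild rchild F G (Suc n) 0 (parent x)"
    by (simp add: dF_def) (simp add: parent_def powi_two_add_one)
  finally show ?thesis
    using sum_descendants_le[of F G n x] by (simp add: dF_def dG_def)
qed

text \<open>Two roots are taken, [0, 2^N) and [-2^N, 0), because a dyadic interval never meets both
  half-lines.\<close>

lemma finite_subset_descendants:
  assumes "finite S"
  shows "\<exists>n N. S \<subseteq> descendants n (N, 0) \<union> descendants n (N, -1)"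
proof -
  obtain b where b: "\<And>y. y \<in> S \<Longrightarrow> nat (\<bar>fst y\<bar> + \<bar>snd y\<bar>) \<le> b"
    using finite_nat_set_iff_bounded_le[of "(\<lambda>y. nat (\<bar>fst y\<bar> + \<bar>snd y\<bar>)) ` S"] assms by auto
  \<comment> \<open>The depth \<open>d\<close> of \<open>y\<close> below scale \<open>2 * b\<close>
    lies between \<open>b\<close> and \<open>3 * b\<close>. The lower bound makes the index smaller
    than \<open>2 ^ d\<close> in modulus, so the ancestor has index 0 or -1.\<close>
  have "y \<in> descendants (3 * b + 1) (2 * int b, 0) \<union> descendants (3 * b + 1) (2 * int b, -1)"
    if "y \<in> S" for y
  proof -
    have y: "\<bar>fst y\<bar> \<le> int b" "\<bar>snd y\<bar> \<le> int b" using b[OF that] by linarith+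
    define d where "d = nat (2 * int b - fst y)"
    have d: "d < 3 * b + 1" "fst y = 2 * int b - int d" "b \<le> d" using y by (auto simp: d_def)
    have "b < 2 ^ b" by (rule less_exp)
    also have "\<dots> \<le> 2 ^ d" using d by (intro power_increasing) auto
    finally have "int b < 2 ^ d" by (metis of_nat_less_iff of_nat_numeral of_nat_power)
    then have "snd y < 2 ^ d" "0 \<le> snd y + 2 ^ d" using y by linarith+
    then have "snd y div 2 ^ d = (if 0 \<le> snd y then 0 else -1)"
      using y by (intro int_div_pos_eq[where r = "if 0 \<le> snd y then snd y else snd y + 2 ^ d"]) auto
    then show ?thesis using d by (auto simp: descendants_def split: if_splits)
  qed
  then show ?thesis by blast
qed

text \<open>As |I| = 2 |J|, the factor 2^(-1/2) turns sqrt (|I| |J|) into |J|.\<close>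

lemma haar_coeff_product:
  assumes "set_integrable lebesgue (dyadic (parent y)) f1" "set_integrable lebesgue (dyadic y) f2"
  shows "2 powr (-1/2) * \<bar>haar_coeff f1 (dyadic (parent y))\<bar> * \<bar>haar_coeff f2 (dyadic y)\<bar> =
    2 powi fst y * (\<bar>jump lchild rchild (\<lambda>x. avg f1 (dyadic x)) (parent y)\<bar>
      * \<bar>jump lchild rchild (\<lambda>x. avg f2 (dyadic x)) y\<bar>)"
proof -
  have "2 powr (-1/2) * sqrt (2 powi fst (parent y)) * sqrt (2 powi fst y) = 2 powi fst y"
    by (simp add: parent_def powi_two_add_one real_sqrt_mult powr_minus_divide powr_half_sqrt)
  then show ?thesis
    unfolding haar_coeff_dyadic[OF assms(1)] haar_coeff_dyadic[OF assms(2)]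
    by (simp add: abs_mult)
qed

text \<open>The constant is 2 * 768, one share for each half-line.\<close>

lemma sum_child_pairs_le:
  assumes A2: "A2_weight w" and f1: "in_L2 w f1" and f2: "in_L2 (dual_weight w) f2"
    and P: "finite P" "P \<subseteq> child_pairs"
  shows "(\<Sum>(I, J)\<in>P. 2 powr (-1/2) * \<bar>haar_coeff f1 I\<bar> * \<bar>haar_coeff f2 J\<bar>)
    \<le> 1536 * A2_char w * L2_norm w f1 * L2_norm (dual_weight w) f2"
proof -
  let ?F = "\<lambda>x. avg f1 (dyadic x)" and ?G = "\<lambda>x. avg f2 (dyadic x)"
  let ?A = "\<lambda>x. avg (\<lambda>t. \<bar>f1 t\<bar>\<^sup>2 * w t) (dyadic x)"
  let ?B = "\<lambda>x. avg (\<lambda>t. \<bar>f2 t\<bar>\<^sup>2 * dual_weight w t) (dyadic x)"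
  let ?K = "A2_char w * L2_norm w f1 * L2_norm (dual_weight w) f2"
  let ?g = "\<lambda>(I, J). 2 powr (-1/2) * \<bar>haar_coeff f1 I\<bar> * \<bar>haar_coeff f2 J\<bar>"
  let ?h = "\<lambda>y. (dyadic (parent y), dyadic y)"
  let ?t = "\<lambda>y. 2 powi fst y * (\<bar>jump lchild rchild ?F (parent y)\<bar> * \<bar>jump lchild rchild ?G y\<bar>)"
  interpret T: weighted_tree lchild rchild ?F ?G "\<lambda>x. avg (\<lambda>t. \<bar>f1 t\<bar>) (dyadic x)"
    "\<lambda>x. avg (\<lambda>t. \<bar>f2 t\<bar>) (dyadic x)" ?A ?B
    "\<lambda>x. avg w (dyadic x)" "\<lambda>x. avg (dual_weight w) (dyadic x)" "A2_char w"
    by (rule weighted_tree_dyadic(1)[OF A2 f1 f2])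
  have nonneg: "0 \<le> w t" "0 \<le> dual_weight w t" for t
    using A2 by (auto simp: A2_weight_def dual_weight_def)
  \<comment> \<open>The length splits into two square roots that turn both averages into integrals
    over the interval, so the bound is uniform over all roots.\<close>
  have root: "2 powi fst x * (768 * A2_char w * sqrt (?A x * ?B x)) \<le> 768 * ?K" for x
  proof -
    have "2 powi fst x * ?A x \<le> (\<integral>t. \<bar>f1 t\<bar>\<^sup>2 * w t \<partial>lebesgue)"
      using f1 nonneg by (intro measure_avg_le) (auto simp: in_L2_def)
    moreover have "2 powi fst x * ?B x \<le> (\<integral>t. \<bar>f2 t\<bar>\<^sup>2 * dual_weight w t \<partial>lebesgue)"
      using f2 nonneg by (intro measure_avg_le) (auto simp: in_L2_def)
    ultimately have "sqrt (2 powi fst x * ?A x) * sqrt (2 powi fst x * ?B x)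
        \<le> L2_norm w f1 * L2_norm (dual_weight w) f2"
      unfolding L2_norm_def using nonneg
      by (intro mult_mono real_sqrt_le_mono)
         (auto intro!: Bochner_Integration.integral_nonneg mult_nonneg_nonneg avg_nonneg)
    moreover have "sqrt (2 powi fst x * ?A x) * sqrt (2 powi fst x * ?B x)
        = 2 powi fst x * sqrt (?A x * ?B x)"
      by (simp add: real_sqrt_mult)
    ultimately have "768 * A2_char w * (2 powi fst x * sqrt (?A x * ?B x))
        \<le> 768 * A2_char w * (L2_norm w f1 * L2_norm (dual_weight w) f2)"
      using T.Q_ge_1 by (intro mult_left_mono) auto
    then show ?thesis by (simp add: mult_ac)
  qed
  have part: "sum ?t (descendants n x) \<le> 768 * ?K" for n x
  proof -
    have "sum ?t (descendants n x)
        \<le> 2 powi fst (parent x) * shift_sum lchild rchild ?F ?G (Suc n) 0 (parent x)"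
      by (rule sum_descendants_le_parent)
    also have "\<dots> \<le> 2 powi fst (parent x) * (768 * A2_char w * sqrt (?A (parent x) * ?B (parent x)))"
      by (intro mult_left_mono T.shift_sum_le) auto
    also have "\<dots> \<le> 768 * ?K" by (rule root)
    finally show ?thesis .
  qed
  obtain S where S: "finite S" "P = ?h ` S"
    using finite_subset_image[OF P(1), of ?h UNIV] P(2) child_pairs_subset by blast
  obtain n N where nN: "S \<subseteq> descendants n (N, 0) \<union> descendants n (N, -1)"
    using finite_subset_descendants[OF S(1)] by blast
  have "sum ?g P \<le> sum (?g \<circ> ?h) S"
    unfolding S(2) by (rule sum_image_le) (auto simp: S(1))
  also have "\<dots> = sum ?t S"
    using haar_coeff_product weighted_tree_dyadic(2,3)[OF A2 f1 f2] by (intro sum.cong) auto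
  also have "\<dots> \<le> sum ?t (descendants n (N, 0) \<union> descendants n (N, -1))"
    by (intro sum_mono2 nN) (auto simp: finite_descendants)
  also have "\<dots> \<le> sum ?t (descendants n (N, 0)) + sum ?t (descendants n (N, -1))"
    by (intro sum_union_le) (auto simp: finite_descendants)
  also have "\<dots> \<le> 1536 * ?K"
    using part[of n "(N, 0)"] part[of n "(N, -1)"] by linarith
  finally show ?thesis by (simp add: mult_ac)
qed

theorem theorem1p1:
  shows "\<exists>C::real. C > 0 \<and>
    (\<forall>(w :: real \<Rightarrow> real) (c :: real set \<Rightarrow> real set \<Rightarrow> real) (f1 :: real \<Rightarrow> real) (f2 :: real \<Rightarrow> real).
       A2_weight w \<longrightarrow>
       (\<forall>(I, J) \<in> child_pairs. \<bar>c I J\<bar> \<le> 1) \<longrightarrow>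
       in_L2 w f1 \<longrightarrow> in_L2 (dual_weight w) f2 \<longrightarrow>
       (\<lambda>(I, J). \<bar>2 powr (-1/2) * c I J * \<bar>haar_coeff f1 I\<bar> * \<bar>haar_coeff f2 J\<bar>\<bar>)
          summable_on child_pairs \<and>
       (\<Sum>\<^sub>\<infinity>(I, J)\<in>child_pairs. 2 powr (-1/2) * c I J * \<bar>haar_coeff f1 I\<bar> * \<bar>haar_coeff f2 J\<bar>)
         \<le> C * A2_char w * L2_norm w f1 * L2_norm (dual_weight w) f2)"
proof (rule exI[of _ 1536], intro conjI allI impI)
  fix w f1 f2 :: "real \<Rightarrow> real" and c :: "real set \<Rightarrow> real set \<Rightarrow> real"
  assume A2: "A2_weight w" and c: "\<forall>(I, J) \<in> child_pairs. \<bar>c I J\<bar> \<le> 1"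
    and f1: "in_L2 w f1" and f2: "in_L2 (dual_weight w) f2"
  let ?f = "\<lambda>(I, J). 2 powr (-1/2) * c I J * \<bar>haar_coeff f1 I\<bar> * \<bar>haar_coeff f2 J\<bar>"
  let ?K = "1536 * A2_char w * L2_norm w f1 * L2_norm (dual_weight w) f2"
  \<comment> \<open>A bound on absolute partial sums that is uniform in \<open>P\<close> gives both
    absolute convergence and the estimate.\<close>
  have bound: "(\<Sum>p\<in>P. \<bar>?f p\<bar>) \<le> ?K" if P: "finite P" "P \<subseteq> child_pairs" for P
  proof -
    have "(\<Sum>p\<in>P. \<bar>?f p\<bar>) \<le> (\<Sum>(I, J)\<in>P. 2 powr (-1/2) * \<bar>haar_coeff f1 I\<bar> * \<bar>haar_coeff f2 J\<bar>)"
    proof (rule sum_mono, clarify)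
      fix I J assume "(I, J) \<in> P"
      then have "\<bar>c I J\<bar> \<le> 1" using c P by auto
      then have "\<bar>c I J\<bar> * (2 powr (-1/2) * \<bar>haar_coeff f1 I\<bar> * \<bar>haar_coeff f2 J\<bar>)
          \<le> 1 * (2 powr (-1/2) * \<bar>haar_coeff f1 I\<bar> * \<bar>haar_coeff f2 J\<bar>)"
        by (intro mult_right_mono) auto
      then show "\<bar>2 powr (-1/2) * c I J * \<bar>haar_coeff f1 I\<bar> * \<bar>haar_coeff f2 J\<bar>\<bar>
          \<le> 2 powr (-1/2) * \<bar>haar_coeff f1 I\<bar> * \<bar>haar_coeff f2 J\<bar>"
        by (simp add: abs_mult mult_ac)
    qed
    also have "\<dots> \<le> ?K" by (rule sum_child_pairs_le[OF A2 f1 f2 P])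
    finally show ?thesis .
  qed
  have summ: "(\<lambda>p. \<bar>?f p\<bar>) summable_on child_pairs"
    using bound by (intro nonneg_bdd_above_summable_on bdd_aboveI[where M = ?K]) auto
  then show "(\<lambda>(I, J). \<bar>2 powr (-1/2) * c I J * \<bar>haar_coeff f1 I\<bar> * \<bar>haar_coeff f2 J\<bar>\<bar>)
      summable_on child_pairs"
    by (simp add: case_prod_unfold)
  have "?f summable_on child_pairs"
    using summ abs_summable_summable[of ?f child_pairs] by simp
  moreover have "sum ?f P \<le> ?K" if "finite P" "P \<subseteq> child_pairs" for P
    using bound[OF that] sum_abs[of ?f P] by linarith
  ultimately show "infsum ?f child_pairs \<le> ?K"
    by (rule infsum_le_finite_sums)
qed simp

end
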